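(* Let $\varphi:X\to Y$ be a local homeomorphism between second-countable locally compact Hausdorff spaces and let $\mu$ be a regular Borel measure on $Y$. Let $\lambda$ be the unique regular Borel measure on $X$ such that $\lambda(U)=\mu(\varphi(U))$ for all open subsets $U\subset X$ for which $\varphi|_U$ is injective. Let $\nu$ be the unique regular Borel measure on $X$ such that $$\int_Xf\,d\nu=\int_Y\sum_{x\in\varphi^{-1}(y)}f(x)\,d\mu(y)\quad\text{for all } f\in C_c(X).$$ Then $\lambda=\nu$.
   Context: A Borel measure (with values in $[0,\infty]$) is regular if it is inner regular, outer regular and finite on compact sets. $C_c(X)$ is the space of continuous compactly supported complex-valued functions on $X$. For $f\in C_c(X)$ the function $y\mapsto\sum_{x\in\varphi^{-1}(y)}f(x)$ is well-defined and belongs to $C_c(Y)$. The measures $\lambda$ and $\nu$ both exist and are unique (two ways of defining the pullback $\varphi^*\mu$). *)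

theory Defs
  imports "HOL-Analysis.Analysis"
begin

definition local_homeomorphism :: "('a::topological_space \<Rightarrow> 'b::topological_space) \<Rightarrow> bool" where
  "local_homeomorphism \<phi> \<longleftrightarrow>
     (\<forall>x. \<exists>U. open U \<and> x \<in> U \<and> open (\<phi> ` U) \<and> (\<exists>\<psi>. homeomorphism U (\<phi> ` U) \<phi> \<psi>))"

definition regular_borel_measure :: "'a::topological_space measure \<Rightarrow> bool" where
  "regular_borel_measure M \<longleftrightarrow>
     sets M = sets borel \<and>
     (\<forall>B\<in>sets borel. emeasure M B = (SUP K\<in>{K. compact K \<and> K \<subseteq> B}. emeasure M K)) \<and>
     (\<forall>B\<in>sets borel. emeasure M B = (INF U\<in>{U. open U \<and> B \<subseteq> U}. emeasure M U)) \<and>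
     (\<forall>K. compact K \<longrightarrow> emeasure M K < \<infinity>)"

definition continuous_compact_support :: "('a::topological_space \<Rightarrow> complex) set" where
  "continuous_compact_support =
     {f. continuous_on UNIV f \<and> compact (closure {x. f x \<noteq> 0})}"

(* A fibre of \<phi> may be infinite, where the library's finite sum is 0 by convention, so the
   sum over the fibre is an infsum.  For \<phi> a local homeomorphism into a Hausdorff space and f
   of compact support only finitely many terms are nonzero, and infsum is their finite sum. *)
definition fibre_sum :: "('a \<Rightarrow> 'b) \<Rightarrow> ('a \<Rightarrow> complex) \<Rightarrow> 'b \<Rightarrow> complex" where
  "fibre_sum \<phi> f y = (\<Sum>\<^sub>\<infinity>x\<in>\<phi> -` {y}. f x)"

end

theory Submission
  imports Defs
begin

text \<open>
  Let \<open>U\<close> be an open set mapped by \<open>\<phi>\<close> homeomorphically onto an open set. For \<open>f\<close> compactly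
  supported in \<open>U\<close> the fibre sum of \<open>f\<close> is the transport of \<open>f\<close> to \<open>\<phi> ` U\<close> (extended by zero).
  Testing the integral identity on Urysohn functions squeezed between a compact subset of \<open>U\<close>
  and \<open>U\<close> and using inner regularity of both \<open>\<mu>\<close> and \<open>\<nu>\<close> yields \<open>\<nu> U = \<mu> (\<phi> ` U)\<close>. So \<open>\<nu>\<close>
  agrees with \<open>lam\<close> on all small open sets, and these form an intersection-stable generator of the
  Borel sets containing a countable cover by sets of finite measure.
\<close>

lemma Hausdorff_space_euclidean_t2: "Hausdorff_space (euclidean :: 'a::t2_space topology)"
  by (simp add: Hausdorff_space_def disjnt_def separation_t2)

text \<open>Uniqueness of measures on an intersection-stable generator. Agreement is required on all
  open subsets \<open>V\<close> of \<open>W\<close>, since agreement on \<open>W\<close> alone would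
  not pass to intersections.\<close>

lemma measure_eqI_locally_open:
  fixes M N :: "'a::second_countable_topology measure"
  assumes sets: "sets M = sets borel" "sets N = sets borel"
    and loc: "\<And>x. \<exists>W. open W \<and> x \<in> W \<and> emeasure M W < \<infinity> \<and>
                 (\<forall>V. open V \<longrightarrow> V \<subseteq> W \<longrightarrow> emeasure M V = emeasure N V)"
  shows "M = N"
proof -
  define E where "E = {W. open W \<and> emeasure M W < \<infinity> \<and>
                 (\<forall>V. open V \<longrightarrow> V \<subseteq> W \<longrightarrow> emeasure M V = emeasure N V)}"
  have E: "open W" "emeasure M W < \<infinity>" "emeasure M W = emeasure N W" if "W \<in> E" for W
    using that unfolding E_def by blast+
  have down: "V \<in> E" if "W \<in> E" "open V" "V \<subseteq> W" for V W
  proof -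
    have "emeasure M V \<le> emeasure M W"
      using that by (intro emeasure_mono) (auto simp: sets dest: E(1))
    then show ?thesis
      using that order_le_less_trans[of "emeasure M V" "emeasure M W" \<infinity>]
      unfolding E_def mem_Collect_eq by (meson order_trans)
  qed
  \<comment> \<open>The Lindelof property turns a cover of \<open>S\<close> by members of
    \<open>E\<close> into a countable one. For arbitrary open \<open>S\<close> this shows that
    \<open>E\<close> generates the Borel sets; for the whole space it gives the countable cover by
    sets of finite measure.\<close>
  have union: "\<exists>F. F \<subseteq> E \<and> countable F \<and> \<Union>F = S" if "open S" for S
  proof -
    have "open V" if "V \<in> {V \<in> E. V \<subseteq> S}" for V
      using that E(1) by simp
    then obtain F where F: "F \<subseteq> {V \<in> E. V \<subseteq> S}" "countable F"
        "\<Union>F = \<Union>{V \<in> E. V \<subseteq> S}"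
      by (rule Lindelof)
    moreover have "\<Union>{V \<in> E. V \<subseteq> S} = S"
    proof (intro equalityI subsetI)
      fix x assume "x \<in> S"
      obtain W where "W \<in> E" "x \<in> W"
        using loc[of x] unfolding E_def by blast
      then have "W \<inter> S \<in> E"
        using \<open>open S\<close> E(1) down[of W "W \<inter> S"] by (simp add: open_Int)
      then show "x \<in> \<Union>{V \<in> E. V \<subseteq> S}"
        using \<open>x \<in> W\<close> \<open>x \<in> S\<close> by blast
    qed auto
    ultimately have "\<Union>F = S"
      by (simp only:)
    moreover have "F \<subseteq> E"
      using F(1) by blast
    ultimately show ?thesis
      using F(2) by metis
  qed
  have "(borel :: 'a measure) = sigma UNIV E"
    unfolding borel_def
  proof (intro sigma_eqI sigma_sets_eqI, safe)
    fix S :: "'a set" assume "open S"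
    then obtain F where "F \<subseteq> E" "countable F" "S = \<Union>F"
      using union by blast
    then show "S \<in> sigma_sets UNIV E"
      by (auto intro: sigma_sets_UNION)
  next
    fix S assume "S \<in> E"
    then show "S \<in> sigma_sets UNIV (Collect open)"
      by (auto dest: E(1))
  qed simp_all
  then have sigma: "sets (borel :: 'a measure) = sigma_sets UNIV E"
    by (metis Pow_UNIV sets_measure_of top_greatest)
  obtain A where A: "A \<subseteq> E" "countable A" "\<Union>A = UNIV"
    using union[OF open_UNIV] by blast
  show ?thesis
  proof (rule measure_eqI_generator_eq_countable[where E = E and A = A and \<Omega> = UNIV])
    show "Int_stable E"
    proof (rule Int_stableI)
      fix V W assume "V \<in> E" "W \<in> E"
      then show "V \<inter> W \<in> E"
        using down[of V "V \<inter> W"] E(1) by (simp add: open_Int)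
    qed
    show "emeasure M W \<noteq> \<infinity>" if "W \<in> A" for W
      using E(2)[of W] A(1) that by auto
    show "sets M = sigma_sets UNIV E" "sets N = sigma_sets UNIV E"
      using sets sigma by (simp_all only:)
  qed (use A E(3) in simp_all)
qed

text \<open>A locally compact Hausdorff space is completely regular, so a continuous function
  separates \<open>K\<close> from the complement of a small open neighbourhood.\<close>

lemma locally_compact_Urysohn:
  fixes K U :: "'a::t2_space set"
  assumes lc: "locally_compact_space (euclidean :: 'a topology)"
    and K: "compact K" "open U" "K \<subseteq> U"
  obtains f :: "'a \<Rightarrow> real"
  where "continuous_on UNIV f" "\<And>x. 0 \<le> f x" "\<And>x. f x \<le> 1" "\<And>x. x \<in> K \<Longrightarrow> f x = 1"
    "compact (closure {x. f x \<noteq> 0})" "closure {x. f x \<noteq> 0} \<subseteq> U"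
proof -
  have T2: "Hausdorff_space (euclidean :: 'a topology)"
    by (rule Hausdorff_space_euclidean_t2)
  have cr: "completely_regular_space (euclidean :: 'a topology)"
    by (intro locally_compact_regular_imp_completely_regular_space
        locally_compact_Hausdorff_imp_regular_space lc disjI1 T2)
  \<comment> \<open>The neighbourhood \<open>V\<close> is kept inside a compact \<open>L\<close>, so
    that a closed support contained in \<open>V\<close> is compact.\<close>
  obtain V L where VL: "open V" "compact L" "K \<subseteq> V" "V \<subseteq> L"
    using lc K locally_compact_space_compact_closed_compact[of "euclidean :: 'a topology"] T2
    by auto
  have "closedin euclidean (- (V \<inter> U))" "disjnt K (- (V \<inter> U))"
    using VL K by (auto simp: disjnt_iff simp del: Compl_Int)
  then obtain g :: "'a \<Rightarrow> real" where g: "continuous_map euclidean (top_of_set {0..1}) g"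
      "g ` (- (V \<inter> U)) \<subseteq> {0}" "g ` K \<subseteq> {1}"
    using Urysohn_completely_regular_compact_closed[of 0 1 euclidean K "- (V \<inter> U)"] cr K by auto
  have cont: "continuous_on UNIV g" and g01: "\<And>x. 0 \<le> g x" "\<And>x. g x \<le> 1"
    using g(1) by (auto simp: continuous_map_in_subtopology image_subset_iff Pi_iff)
  txt \<open>Cutting \<open>g\<close> off at level one half moves the closure of the support into \<open>U\<close>.\<close>
  define f where "f x = max 0 (2 * g x - 1)" for x
  have "closed {x. 1/2 \<le> g x}"
    by (intro closed_Collect_le continuous_intros cont)
  then have supp: "closure {x. f x \<noteq> 0} \<subseteq> {x. 1/2 \<le> g x}"
    by (intro closure_minimal) (auto simp: f_def max_def split: if_splits)
  have "{x. 1/2 \<le> g x} \<subseteq> V \<inter> U"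
  proof
    fix x assume "x \<in> {x. 1/2 \<le> g x}"
    then have "g x \<noteq> 0" by auto
    then show "x \<in> V \<inter> U" using g(2) by blast
  qed
  with supp have sub: "closure {x. f x \<noteq> 0} \<subseteq> V \<inter> U" by blast
  show thesis
  proof (rule that[of f])
    show "continuous_on UNIV f"
      unfolding f_def by (intro continuous_intros cont)
    have "L \<inter> closure {x. f x \<noteq> 0} = closure {x. f x \<noteq> 0}"
      using sub VL by blast
    then show "compact (closure {x. f x \<noteq> 0})"
      using compact_Int_closed[OF VL(2) closed_closure] by metis
    show "f x = 1" if "x \<in> K" for x
      using g(3) that by (auto simp: f_def)
    show "f x \<le> 1" for x using g01(2)[of x] by (auto simp: f_def)
  qed (use sub in \<open>auto simp: f_def\<close>)
qed

text \<open>The function lies between the indicators of \<open>K\<close> and \<open>L\<close>.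
  Finite measure of \<open>L\<close> makes it integrable, so its Bochner integral is not the default
  value 0 and equals the nonnegative integral, which is monotone.\<close>

lemma integral_indicator_bounds:
  fixes g :: "'a \<Rightarrow> real"
  assumes g: "g \<in> borel_measurable M" and K: "K \<in> sets M" and L: "L \<in> sets M" "emeasure M L < \<infinity>"
    and g01: "\<And>x. 0 \<le> g x" "\<And>x. g x \<le> 1"
    and g1: "\<And>x. x \<in> K \<Longrightarrow> g x = 1" and g0: "\<And>x. x \<notin> L \<Longrightarrow> g x = 0"
  shows "emeasure M K \<le> ennreal (\<integral>x. g x \<partial>M)" "ennreal (\<integral>x. g x \<partial>M) \<le> emeasure M L"
proof -
  have "integrable M g"
    by (rule integrableI_bounded_set[OF L(1) g L(2), of 1]) (auto simp: g01 g0)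
  then have eq: "(\<integral>\<^sup>+x. ennreal (g x) \<partial>M) = ennreal (\<integral>x. g x \<partial>M)"
    by (intro nn_integral_eq_integral) (auto simp: g01)
  have "emeasure M K = (\<integral>\<^sup>+x. indicator K x \<partial>M)"
    using K by simp
  also have "\<dots> \<le> (\<integral>\<^sup>+x. ennreal (g x) \<partial>M)"
    by (intro nn_integral_mono) (auto simp: g1 indicator_def)
  finally show "emeasure M K \<le> ennreal (\<integral>x. g x \<partial>M)"
    by (simp add: eq)
  have "(\<integral>\<^sup>+x. ennreal (g x) \<partial>M) \<le> (\<integral>\<^sup>+x. indicator L x \<partial>M)"
    using g0 by (intro nn_integral_mono) (auto simp: g01 indicator_def)
  also have "\<dots> = emeasure M L"
    using L by simp
  finally show "ennreal (\<integral>x. g x \<partial>M) \<le> emeasure M L"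
    by (simp add: eq)
qed

lemma emeasure_le_compact:
  assumes "regular_borel_measure M" "B \<in> sets borel"
    and "\<And>K. compact K \<Longrightarrow> K \<subseteq> B \<Longrightarrow> emeasure M K \<le> c"
  shows "emeasure M B \<le> c"
proof -
  have "emeasure M B = (SUP K\<in>{K. compact K \<and> K \<subseteq> B}. emeasure M K)"
    using assms by (auto simp: regular_borel_measure_def)
  also have "\<dots> \<le> c" using assms(3) by (intro SUP_least) auto
  finally show ?thesis .
qed

text \<open>The left inverse \<open>\<psi>\<close> makes \<open>\<phi>\<close> injective on
  \<open>U\<close>, so a fibre meets \<open>U\<close> in at most one point and the sum has at most
  one nonzero term. Off the image of \<open>U\<close> the value of \<open>\<psi>\<close> is
  arbitrary and the indicator removes it.\<close>

lemma fibre_sum_supported: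
  fixes f :: "'a \<Rightarrow> complex"
  assumes inv: "\<And>x. x \<in> U \<Longrightarrow> \<psi> (\<phi> x) = x" and f0: "\<And>x. x \<notin> U \<Longrightarrow> f x = 0"
  shows "fibre_sum \<phi> f y = indicator (\<phi> ` U) y * f (\<psi> y)"
proof (cases "y \<in> \<phi> ` U")
  case True
  then obtain x where x: "x \<in> U" "y = \<phi> x" by auto
  have "infsum f (\<phi> -` {y}) = infsum f {x}"
  proof (rule infsum_cong_neutral)
    show "f z = 0" if z: "z \<in> \<phi> -` {y} - {x}" for z
    proof (rule f0, rule notI)
      assume "z \<in> U"
      have "\<phi> z = \<phi> x" "z \<noteq> x"
        using z x(2) by auto
      then show False
        using inv[OF \<open>z \<in> U\<close>] inv[OF x(1)] by metis
    qed
  qed (use x in auto)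
  then show ?thesis
    using x(1) by (simp add: fibre_sum_def x(2) inv)
next
  case False
  then have "infsum f (\<phi> -` {y}) = 0"
    by (intro infsum_0) (auto intro!: f0)
  then show ?thesis using False by (simp add: fibre_sum_def)
qed

text \<open>Both sides may be infinite, so they are compared through compact subsets, where the
  integrals of cut-off functions are finite.\<close>

lemma emeasure_homeomorphism_chart:
  fixes \<phi> :: "'a::t2_space \<Rightarrow> 'b::t2_space"
  assumes lc: "locally_compact_space (euclidean :: 'a topology)"
    and mu: "regular_borel_measure \<mu>" and nu: "regular_borel_measure \<nu>"
    and int: "\<And>f. f \<in> continuous_compact_support \<Longrightarrow>
           (\<integral>x. f x \<partial>\<nu>) = (\<integral>y. fibre_sum \<phi> f y \<partial>\<mu>)"
    and U: "open U" "open (\<phi> ` U)" and hom: "homeomorphism U (\<phi> ` U) \<phi> \<psi>"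
  shows "emeasure \<nu> U = emeasure \<mu> (\<phi> ` U)"
proof -
  have sets [measurable_cong]: "sets \<mu> = sets borel" "sets \<nu> = sets borel"
    and fin: "\<And>K. compact K \<Longrightarrow> emeasure \<mu> K < \<infinity>" "\<And>K. compact K \<Longrightarrow> emeasure \<nu> K < \<infinity>"
    using mu nu by (auto simp: regular_borel_measure_def)
  have inv: "\<psi> (\<phi> x) = x" if "x \<in> U" for x
    using hom that by (simp add: homeomorphism_def)
  have cont: "continuous_on U \<phi>" "continuous_on (\<phi> ` U) \<psi>"
    using hom by (auto simp: homeomorphism_def)
  \<comment> \<open>One cut-off function \<open>f\<close> with transport \<open>g\<close> gives both
    bounds: the equal integrals of \<open>f\<close> and \<open>g\<close> are at least the measures
    of \<open>K\<close> and its image, and at most the measures of the support \<open>L\<close> and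
    its image.\<close>
  have squeeze: "emeasure \<nu> K \<le> emeasure \<mu> (\<phi> ` U) \<and> emeasure \<mu> (\<phi> ` K) \<le> emeasure \<nu> U"
    if K: "compact K" "K \<subseteq> U" for K
  proof -
    obtain f :: "'a \<Rightarrow> real" where f: "continuous_on UNIV f" "\<And>x. 0 \<le> f x" "\<And>x. f x \<le> 1"
      "\<And>x. x \<in> K \<Longrightarrow> f x = 1"
      "compact (closure {x. f x \<noteq> 0})" "closure {x. f x \<noteq> 0} \<subseteq> U"
      using locally_compact_Urysohn[OF lc K(1) U(1) K(2)] by blast
    \<comment> \<open>The upper bounds go through \<open>L\<close> rather than \<open>U\<close>: it
      and its image are compact, hence of finite measure.\<close>
    define L where "L = closure {x. f x \<noteq> 0}"
    have L: "compact L" "L \<subseteq> U" and f0: "\<And>x. x \<notin> L \<Longrightarrow> f x = 0"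
      using f closure_subset[of "{x. f x \<noteq> 0}"] by (auto simp: L_def)
    define g where "g y = indicator (\<phi> ` U) y *\<^sub>R f (\<psi> y)" for y
    have "continuous_on (\<phi> ` U) (\<lambda>y. f (\<psi> y))"
      using continuous_on_compose2[OF f(1) cont(2)] by simp
    \<comment> \<open>Continuity of the transport on the open image of \<open>U\<close> suffices
      here; the extension by zero is measurable.\<close>
    then have g_meas: "g \<in> borel_measurable \<mu>"
      unfolding g_def measurable_cong_sets[OF sets(1) refl] using U(2)
      by (intro borel_measurable_continuous_on_indicator) auto
    have f_meas: "f \<in> borel_measurable \<nu>"
      unfolding measurable_cong_sets[OF sets(2) refl]
      by (rule borel_measurable_continuous_onI[OF f(1)])
    have "(\<lambda>x. complex_of_real (f x)) \<in> continuous_compact_support"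
      using f by (auto simp: continuous_compact_support_def intro!: continuous_intros)
    from int[OF this]
    have "complex_of_real (\<integral>x. f x \<partial>\<nu>) = (\<integral>y. fibre_sum \<phi> (\<lambda>x. complex_of_real (f x)) y \<partial>\<mu>)"
      by simp
    also have "\<dots> = (\<integral>y. complex_of_real (g y) \<partial>\<mu>)"
    proof (rule Bochner_Integration.integral_cong[OF refl])
      fix y
      have "fibre_sum \<phi> (\<lambda>x. complex_of_real (f x)) y
          = indicator (\<phi> ` U) y * complex_of_real (f (\<psi> y))"
        by (rule fibre_sum_supported) (use inv L f0 in auto)
      then show "fibre_sum \<phi> (\<lambda>x. complex_of_real (f x)) y = complex_of_real (g y)"
        by (simp add: g_def indicator_def)
    qed
    finally have eq: "(\<integral>x. f x \<partial>\<nu>) = (\<integral>y. g y \<partial>\<mu>)"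
      by (simp add: of_real_eq_iff)
    have compact_image: "compact (\<phi> ` C)" if "compact C" "C \<subseteq> U" for C
      by (rule compact_continuous_image) (use that cont continuous_on_subset in blast)+
    have g0: "g y = 0" if "y \<notin> \<phi> ` L" for y
    proof (cases "y \<in> \<phi> ` U")
      case True
      then obtain x where "x \<in> U" "y = \<phi> x" by auto
      with that show ?thesis by (auto simp: g_def inv intro!: f0)
    qed (simp add: g_def)
    have g1: "g y = 1" if y: "y \<in> \<phi> ` K" for y
    proof -
      obtain x where "x \<in> K" "y = \<phi> x" using y by auto
      moreover have "x \<in> U" using \<open>x \<in> K\<close> K by auto
      ultimately show ?thesis by (simp add: g_def inv f(4))
    qed
    \<comment> \<open>Each of the two facts carries both compactness premises, so every use below
      supplies a compact set together with its image.\<close>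
    have borel: "C \<in> sets \<nu>" "D \<in> sets \<mu>" if "compact C" "compact D" for C D
      using that by (auto simp: sets intro: borel_closed compact_imp_closed)
    note nu_bounds = integral_indicator_bounds[of f \<nu> K L, OF f_meas
        borel(1)[OF K(1) K(1)[THEN compact_image[OF _ K(2)]]] borel(1)[OF L(1) compact_image[OF L]]
        fin(2)[OF L(1)] f(2,3) f(4) f0]
    note mu_bounds = integral_indicator_bounds[of g \<mu> "\<phi> ` K" "\<phi> ` L", OF g_meas
        borel(2)[OF K(1) compact_image[OF K]] borel(2)[OF L(1) compact_image[OF L]]
        fin(1)[OF compact_image[OF L]] _ _ g1 g0]
    have g01: "0 \<le> g y" "g y \<le> 1" for y
      using f(2,3) by (auto simp: g_def indicator_def)
    have "emeasure \<nu> K \<le> emeasure \<mu> (\<phi> ` L)"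
      using nu_bounds(1) mu_bounds(2)[OF g01] eq by (auto intro: order_trans)
    also have "\<dots> \<le> emeasure \<mu> (\<phi> ` U)"
      using U L by (intro emeasure_mono) (auto simp: sets)
    finally have 1: "emeasure \<nu> K \<le> emeasure \<mu> (\<phi> ` U)" .
    have "emeasure \<mu> (\<phi> ` K) \<le> emeasure \<nu> L"
      using nu_bounds(2) mu_bounds(1)[OF g01] eq by (auto intro: order_trans)
    also have "\<dots> \<le> emeasure \<nu> U"
      using U L by (intro emeasure_mono) (auto simp: sets)
    finally show ?thesis using 1 by blast
  qed
  show ?thesis
  proof (rule antisym)
    show "emeasure \<nu> U \<le> emeasure \<mu> (\<phi> ` U)"
      by (rule emeasure_le_compact[OF nu]) (use U squeeze in auto)
    show "emeasure \<mu> (\<phi> ` U) \<le> emeasure \<nu> U"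
    proof (rule emeasure_le_compact[OF mu])
      fix C assume C: "compact C" "C \<subseteq> \<phi> ` U"
      \<comment> \<open>Every compact subset of the image of \<open>U\<close> is the image of a
        compact subset of \<open>U\<close>, so the second half of \<open>squeeze\<close> bounds its
        measure.\<close>
      have "compact (\<psi> ` C)"
        by (rule compact_continuous_image) (use C cont continuous_on_subset in blast)+
      moreover have "\<psi> ` C \<subseteq> U" "\<phi> ` \<psi> ` C = C"
        using C inv by (force simp: image_iff)+
      ultimately show "emeasure \<mu> C \<le> emeasure \<nu> U"
        using squeeze[of "\<psi> ` C"] by simp
    qed (use U in auto)
  qed
qed

theorem proposition3p10:
  fixes \<phi> :: "'a::{second_countable_topology, t2_space} \<Rightarrow> 'b::{second_countable_topology, t2_space}"
    and \<mu> :: "'b measure"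
    and lam \<nu> :: "'a measure"
  assumes "locally_compact_space (euclidean :: 'a topology)"
    and "locally_compact_space (euclidean :: 'b topology)"
    and "local_homeomorphism \<phi>"
    and "regular_borel_measure \<mu>"
    and "regular_borel_measure lam"
    and "\<And>U. open U \<Longrightarrow> inj_on \<phi> U \<Longrightarrow> emeasure lam U = emeasure \<mu> (\<phi> ` U)"
    and "regular_borel_measure \<nu>"
    and "\<And>f. f \<in> continuous_compact_support \<Longrightarrow>
           (\<integral>x. f x \<partial>\<nu>) = (\<integral>y. fibre_sum \<phi> f y \<partial>\<mu>)"
  shows "lam = \<nu>"
proof (rule measure_eqI_locally_open)
  show lam_sets: "sets lam = sets borel" and "sets \<nu> = sets borel"
    using assms by (auto simp: regular_borel_measure_def)
  fix x
  obtain U \<psi> where U: "open U" "x \<in> U" "open (\<phi> ` U)" "homeomorphism U (\<phi> ` U) \<phi> \<psi>"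
    using assms(3) unfolding local_homeomorphism_def by blast
  \<comment> \<open>Intersecting the chart with a relatively compact neighbourhood gives the finite
    measure that the local uniqueness criterion demands.\<close>
  obtain O' K where OK: "open O'" "compact K" "x \<in> O'" "O' \<subseteq> K"
    using assms(1)[unfolded locally_compact_space_def, rule_format, of x] by auto
  have "emeasure lam (U \<inter> O') \<le> emeasure lam K"
    using OK by (intro emeasure_mono) (auto simp: lam_sets intro: borel_closed compact_imp_closed)
  also have "\<dots> < \<infinity>"
    using assms(5) OK(2) by (simp add: regular_borel_measure_def)
  finally have fin: "emeasure lam (U \<inter> O') < \<infinity>" .
  \<comment> \<open>The restriction of a chart to an open subset is again a chart, so both measures
    of \<open>V\<close> equal the \<open>\<mu>\<close>-measure of its image: for
    \<open>\<nu>\<close> by the chart lemma, for \<open>lam\<close> by injectivity.\<close>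
  have "emeasure lam V = emeasure \<nu> V" if V: "open V" "V \<subseteq> U" for V
  proof -
    have "openin (top_of_set (\<phi> ` U)) (\<phi> ` V)"
      using homeomorphism_imp_open_map[OF U(4)] V by (simp add: openin_open_eq U(1))
    then have "open (\<phi> ` V)"
      using U(3) openin_open_trans by blast
    moreover have hom: "homeomorphism V (\<phi> ` V) \<phi> \<psi>"
      using homeomorphism_of_subsets[OF U(4) V(2)] V by blast
    ultimately have "emeasure \<nu> V = emeasure \<mu> (\<phi> ` V)"
      using emeasure_homeomorphism_chart[OF assms(1,4,7,8)] V(1) by blast
    moreover have "inj_on \<phi> V"
      using hom by (metis homeomorphism_apply1 inj_on_inverseI)
    ultimately show ?thesis using assms(6) V(1) by simp
  qed
  then show "\<exists>W. open W \<and> x \<in> W \<and> emeasure lam W < \<infinity> \<and>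
               (\<forall>V. open V \<longrightarrow> V \<subseteq> W \<longrightarrow> emeasure lam V = emeasure \<nu> V)"
    using U OK fin by (intro exI[of _ "U \<inter> O'"]) auto
qed

end
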